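(* For every positive integer $n$, the maximum forcing number of the hypercube $Q_n$ satisfies $F(Q_n)\le 2^{n-1}-2^{\,n-\lceil\log_2(n+1)\rceil}$.
   Context: The hypercube graph $Q_n$ has vertex set $\{0,1\}^n$, two vertices being adjacent iff they differ in exactly one coordinate. A perfect matching of a graph $G$ is a set $M\subseteq E(G)$ such that every vertex lies in exactly one edge of $M$. A subset $S\subseteq M$ is a forcing set for $M$ if $M$ is the unique perfect matching of $G$ containing $S$. The forcing number of $M$ is $f(G,M)=\min\{|S|: S\text{ is a forcing set for }M\}$, and the maximum forcing number of $G$ is $F(G)=\max\{f(G,M): M\text{ is a perfect matching of }G\}$. *)

theory Defs
  imports Complex_Main
begin

text \<open>An edge is the set of its two endpoints.\<close>

record 'a sgraph =
  verts :: "'a set"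
  edges :: "'a set set"

definition finite_simple_graph :: "'a sgraph \<Rightarrow> bool" where
  "finite_simple_graph G \<longleftrightarrow>
     finite (verts G) \<and> (\<forall>e\<in>edges G. e \<subseteq> verts G \<and> card e = 2)"

definition perfect_matching :: "'a sgraph \<Rightarrow> 'a set set \<Rightarrow> bool" where
  "perfect_matching G M \<longleftrightarrow> M \<subseteq> edges G \<and> (\<forall>v\<in>verts G. \<exists>!e. e \<in> M \<and> v \<in> e)"

definition forcing_set :: "'a sgraph \<Rightarrow> 'a set set \<Rightarrow> 'a set set \<Rightarrow> bool" where
  "forcing_set G M S \<longleftrightarrow>
     S \<subseteq> M \<and> perfect_matching G M \<and>
     (\<forall>M'. perfect_matching G M' \<and> S \<subseteq> M' \<longrightarrow> M' = M)"

text \<open>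
  \<^const>\<open>Min\<close> and \<^const>\<open>Max\<close> are only meaningful on finite nonempty sets. For a finite simple
  graph the sets below are finite; the first is nonempty because a perfect matching forces itself,
  the second is nonempty iff the graph has a perfect matching.
\<close>

definition forcing_number :: "'a sgraph \<Rightarrow> 'a set set \<Rightarrow> nat" where
  "forcing_number G M = Min {card S | S. forcing_set G M S}"

definition max_forcing_number :: "'a sgraph \<Rightarrow> nat" where
  "max_forcing_number G = Max {forcing_number G M | M. perfect_matching G M}"

text \<open>The set \<open>{0,1}\<^sup>n\<close> is represented by the Boolean lists of length \<open>n\<close>.\<close>

definition hypercube :: "nat \<Rightarrow> bool list sgraph" where
  "hypercube n =
     \<lparr>verts = {x. length x = n},
      edges = {{x, y} | x y. length x = n \<and> length y = n \<and> card {i. i < n \<and> x ! i \<noteq> y ! i} = 1}\<rparr>"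

lemma finite_edges:
  assumes "finite_simple_graph G"
  shows "finite (edges G)"
proof (rule finite_subset)
  show "edges G \<subseteq> Pow (verts G)" using assms by (auto simp: finite_simple_graph_def)
  show "finite (Pow (verts G))" using assms by (simp add: finite_simple_graph_def)
qed

lemma forcing_number_set:
  assumes "finite_simple_graph G" "perfect_matching G M"
  shows "finite {card S | S. forcing_set G M S}" "{card S | S. forcing_set G M S} \<noteq> {}"
proof -
  have M: "M \<subseteq> edges G" using assms(2) by (simp add: perfect_matching_def)
  then have "finite (Pow M)" using finite_edges[OF assms(1)] finite_subset by auto
  moreover have "{card S | S. forcing_set G M S} \<subseteq> card ` Pow M"
    by (auto simp: forcing_set_def)
  ultimately show "finite {card S | S. forcing_set G M S}"
    using finite_subset by blast
  have "M' = M" if M': "perfect_matching G M'" "M \<subseteq> M'" for M'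
  proof -
    have "e \<in> M" if e: "e \<in> M'" for e
    proof -
      have "e \<subseteq> verts G" "card e = 2"
        using e M'(1) assms(1) by (auto simp: perfect_matching_def finite_simple_graph_def)
      moreover from this have "e \<noteq> {}" by auto
      ultimately obtain v where v: "v \<in> e" "v \<in> verts G" by blast
      obtain e' where e': "e' \<in> M" "v \<in> e'"
        using assms(2) v(2) unfolding perfect_matching_def by blast
      have "\<exists>!e. e \<in> M' \<and> v \<in> e"
        using M'(1) v(2) unfolding perfect_matching_def by blast
      then have "e' = e" using e e' M'(2) v(1) by blast
      then show ?thesis using e' by simp
    qed
    then show ?thesis using M'(2) by blast
  qed
  then have "forcing_set G M M" using assms(2) by (simp add: forcing_set_def)
  then show "{card S | S. forcing_set G M S} \<noteq> {}" by blast
qed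

lemma max_forcing_number_set:
  assumes "finite_simple_graph G"
  shows "finite {forcing_number G M | M. perfect_matching G M}"
proof (rule finite_subset)
  show "{forcing_number G M | M. perfect_matching G M} \<subseteq> forcing_number G ` Pow (edges G)"
    by (auto simp: perfect_matching_def)
  show "finite (forcing_number G ` Pow (edges G))" using finite_edges[OF assms] by simp
qed

lemma finite_simple_graph_hypercube: "finite_simple_graph (hypercube n)"
proof -
  have "finite {x :: bool list. length x = n}"
    using finite_lists_length_eq[of "UNIV :: bool set" n] by simp
  moreover have "card {x, y} = 2" if "card {i. i < n \<and> x ! i \<noteq> y ! i} = 1" for x y :: "bool list"
  proof -
    have "x \<noteq> y" using that by auto
    then show ?thesis by simp
  qed
  ultimately show ?thesis
    by (auto simp: finite_simple_graph_def hypercube_def)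
qed

lemma hypercube_has_perfect_matching:
  assumes "n \<ge> 1"
  shows "\<exists>M. perfect_matching (hypercube n) M"
proof
  let ?M = "{{False # z, True # z} | z. length z = n - 1}"
  have "{i. i < n \<and> (False # z) ! i \<noteq> (True # z) ! i} = {0}" for z
    using assms by (auto simp: nth_Cons')
  then have "card {i. i < n \<and> (False # z) ! i \<noteq> (True # z) ! i} = 1" for z
    by simp
  then have "{False # z, True # z} \<in> edges (hypercube n)" if "length z = n - 1" for z
    unfolding hypercube_def sgraph.simps mem_Collect_eq using that assms
    by (intro exI[of _ "False # z"] exI[of _ "True # z"]) (simp del: nth_Cons_0)
  then have "?M \<subseteq> edges (hypercube n)" by blast
  moreover have "\<exists>!e. e \<in> ?M \<and> v \<in> e" if len: "length v = n" for v
  proof -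
    obtain b z where v: "v = b # z" using len assms by (cases v) auto
    show ?thesis
    proof (rule ex1I)
      show "{False # z, True # z} \<in> ?M \<and> v \<in> {False # z, True # z}"
        using v len by (cases b) auto
    qed (use v in auto)
  qed
  ultimately show "perfect_matching (hypercube n) ?M"
    by (simp add: perfect_matching_def hypercube_def)
qed

end

theory Submission
  imports Defs
begin

text \<open>
  Let \<open>M\<close> be a perfect matching of a graph and let \<open>C\<close> be a set of vertices whose closed
  neighbourhoods are pairwise disjoint. Remove from \<open>M\<close> the edges that meet \<open>C\<close>. What remains still
  forces \<open>M\<close>: the vertices that it leaves uncovered are those of \<open>C\<close> and their partners, and among
  them a vertex \<open>v\<close> of \<open>C\<close> has no neighbour but its own partner, since any other
  such neighbour would lie in the closed neighbourhoods of \<open>v\<close> and of another vertex of \<open>C\<close>. Hence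
  the forcing number of \<open>M\<close> is at most \<open>|M| - |C|\<close> (\<open>forcing_number_le_packing\<close>).

  In \<open>Q\<^sub>n\<close> a large \<open>C\<close> comes from the syndrome of the Hamming code: label the coordinates
  by \<open>1, \<dots>, n\<close> and map a vertex to the exclusive or of the labels of its ones. Flipping a
  coordinate adds its nonzero label and distinct coordinates have distinct labels, so the
  syndrome is injective on each closed neighbourhood, and its fibres are packings. If
  \<open>n + 1 \<le> 2\<^sup>k\<close> then there are at most \<open>2\<^sup>k\<close> nonempty fibres, and by the pigeonhole principle one of them has
  at least \<open>2\<^sup>n\<^sup>-\<^sup>k\<close> elements. The least such \<open>k\<close> is \<open>\<lceil>log\<^sub>2 (n + 1)\<rceil>\<close>.
\<close>

section \<open>Packings and forcing sets\<close>

text \<open>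
  Disjointness of the closed neighbourhoods, split into its two cases: distinct members of \<open>C\<close> are
  neither adjacent nor joined through a common neighbour.
\<close>

definition packing :: "'a sgraph \<Rightarrow> 'a set \<Rightarrow> bool" where
  "packing G C \<longleftrightarrow> C \<subseteq> verts G \<and>
     (\<forall>u\<in>C. \<forall>v\<in>C. {u, v} \<in> edges G \<longrightarrow> u = v) \<and>
     (\<forall>u\<in>C. \<forall>v\<in>C. \<forall>w. {u, w} \<in> edges G \<and> {v, w} \<in> edges G \<longrightarrow> u = v)"

lemma edge_other_end:
  assumes "finite_simple_graph G" "e \<in> edges G" "v \<in> e"
  obtains w where "e = {v, w}" "w \<noteq> v" "w \<in> verts G"
proof -
  have e: "e \<subseteq> verts G" "card e = 2"
    using assms by (auto simp: finite_simple_graph_def)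
  then obtain a b where ab: "e = {a, b}" "a \<noteq> b" by (meson card_2_iff)
  show thesis
  proof (cases "v = a")
    case True
    then show thesis using that[of b] ab e by auto
  next
    case False
    then show thesis using that[of a] ab e assms(3) by auto
  qed
qed

lemma perfect_matching_unique_edge:
  assumes "perfect_matching G M" "v \<in> verts G" "e \<in> M" "e' \<in> M" "v \<in> e" "v \<in> e'"
  shows "e = e'"
  using assms unfolding perfect_matching_def by blast

lemma perfect_matching_subset_eq:
  assumes G: "finite_simple_graph G"
    and M: "perfect_matching G M" and M': "perfect_matching G M'" and sub: "M \<subseteq> M'"
  shows "M' = M"
proof
  show "M' \<subseteq> M"
  proof
    fix e assume e: "e \<in> M'"
    then have E: "e \<in> edges G" using M' by (auto simp: perfect_matching_def)
    then have "e \<subseteq> verts G" "card e = 2" using G by (auto simp: finite_simple_graph_def)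
    moreover from this have "e \<noteq> {}" by auto
    ultimately obtain v where v: "v \<in> e" "v \<in> verts G" by blast
    then obtain e' where "e' \<in> M" "v \<in> e'" using M unfolding perfect_matching_def by blast
    then show "e \<in> M"
      using perfect_matching_unique_edge[OF M' v(2) e _ v(1)] sub by blast
  qed
qed (fact sub)

lemma card_perfect_matching:
  assumes G: "finite_simple_graph G" and M: "perfect_matching G M"
  shows "2 * card M = card (verts G)"
proof -
  have E: "M \<subseteq> edges G" using M by (simp add: perfect_matching_def)
  have fin: "finite M" using E finite_edges[OF G] finite_subset by blast
  have U: "\<Union>M = verts G"
    using E G M unfolding perfect_matching_def finite_simple_graph_def by blast
  have "2 * card M = card (\<Union>M)"
  proof (rule card_partition)
    show "finite (\<Union>M)" using U G by (simp add: finite_simple_graph_def)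
    show "card c = 2" if "c \<in> M" for c
      using that E G by (auto simp: finite_simple_graph_def)
    show "c1 \<inter> c2 = {}" if "c1 \<in> M" "c2 \<in> M" "c1 \<noteq> c2" for c1 c2
      using that perfect_matching_unique_edge[OF M] U by blast
  qed (fact fin)
  then show ?thesis using U by simp
qed

text \<open>
  Suppose that another perfect matching contains the remaining edges and joins \<open>v \<in> C\<close> to \<open>w\<close>.
  Then the edge of \<open>M\<close> at \<open>w\<close> was removed, so it meets \<open>C\<close> in some \<open>u\<close>; as \<open>w\<close> lies in the closed
  neighbourhoods of both \<open>u\<close> and \<open>v\<close>, these coincide, and \<open>w\<close> is the \<open>M\<close>-partner of \<open>v\<close>.
\<close>

lemma forcing_set_avoiding_packing:
  assumes G: "finite_simple_graph G" and M: "perfect_matching G M" and C: "packing G C"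
  shows "forcing_set G M {e \<in> M. e \<inter> C = {}}"
  unfolding forcing_set_def
proof (intro conjI allI impI M)
  let ?S = "{e \<in> M. e \<inter> C = {}}"
  show "?S \<subseteq> M" by blast
  fix M' assume "perfect_matching G M' \<and> ?S \<subseteq> M'"
  then have M': "perfect_matching G M'" and S: "?S \<subseteq> M'" by auto
  have E: "M \<subseteq> edges G" and E': "M' \<subseteq> edges G"
    using M M' by (auto simp: perfect_matching_def)
  have "e \<in> M'" if e: "e \<in> M" "v \<in> e" "v \<in> C" for e v
  proof -
    have vV: "v \<in> verts G" using e C by (auto simp: packing_def)
    then obtain f where f: "f \<in> M'" "v \<in> f" using M' unfolding perfect_matching_def by blast
    then obtain w where w: "f = {v, w}" "w \<noteq> v" "w \<in> verts G"
      using edge_other_end[OF G] E' by blast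
    obtain g where g: "g \<in> M" "w \<in> g" using M w(3) unfolding perfect_matching_def by blast
    have "g \<notin> ?S"
    proof
      assume gS: "g \<in> ?S"
      then have "g = f" using perfect_matching_unique_edge[OF M' w(3)] g f w(1) S by blast
      then show False using gS f e(3) by blast
    qed
    then obtain u where u: "u \<in> g" "u \<in> C" using g by blast
    have "u \<noteq> w"
    proof
      assume "u = w"
      then have "v = w" using C e(3) u(2) f(1) w(1) E' unfolding packing_def by blast
      then show False using w(2) by simp
    qed
    then have guw: "g = {u, w}" using edge_other_end[OF G _ u(1)] g E by blast
    then have "u = v" using C e(3) u(2) f(1) w(1) E' E g(1) unfolding packing_def by blast
    then have "g = f" "e = g"
      using guw w(1) perfect_matching_unique_edge[OF M vV e(1) g(1) e(2)] by auto
    then show ?thesis using f(1) by simp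
  qed
  then have "M \<subseteq> M'" using S by blast
  then show "M' = M" by (rule perfect_matching_subset_eq[OF G M M'])
qed

lemma forcing_number_le_packing:
  assumes G: "finite_simple_graph G" and M: "perfect_matching G M" and C: "packing G C"
  shows "forcing_number G M + card C \<le> card M"
proof -
  let ?S = "{e \<in> M. e \<inter> C = {}}" and ?T = "{e \<in> M. e \<inter> C \<noteq> {}}"
  have E: "M \<subseteq> edges G" using M by (simp add: perfect_matching_def)
  have fin: "finite M" using E finite_edges[OF G] finite_subset by blast
  have "\<forall>v\<in>C. \<exists>e. e \<in> M \<and> v \<in> e"
    using M C unfolding perfect_matching_def packing_def by blast
  then obtain p where p: "\<And>v. v \<in> C \<Longrightarrow> p v \<in> M \<and> v \<in> p v" by metis
  \<comment> \<open>No edge meets \<open>C\<close> twice, so at least \<open>|C|\<close> edges are removed.\<close>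
  have "inj_on p C"
  proof (rule inj_onI)
    fix u v assume uv: "u \<in> C" "v \<in> C" "p u = p v"
    show "u = v"
    proof (rule ccontr)
      assume "u \<noteq> v"
      obtain w where "p u = {u, w}" using edge_other_end[OF G, of "p u" u] p[OF uv(1)] E by blast
      then have "{u, v} \<in> edges G" using p[OF uv(1)] p[OF uv(2)] uv(3) \<open>u \<noteq> v\<close> E by auto
      then show False using C uv \<open>u \<noteq> v\<close> unfolding packing_def by blast
    qed
  qed
  moreover have "p ` C \<subseteq> ?T" using p by blast
  ultimately have "card C \<le> card ?T" using fin by (intro card_inj_on_le[of p]) auto
  moreover have "card M = card ?S + card ?T"
    using fin by (subst card_Un_disjoint[symmetric]) (auto intro: arg_cong[of _ _ card])
  moreover have "forcing_number G M \<le> card ?S"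
    unfolding forcing_number_def
    using forcing_number_set(1)[OF G M] forcing_set_avoiding_packing[OF G M C]
    by (intro Min_le) auto
  ultimately show ?thesis by linarith
qed

section \<open>The Hamming syndrome on the hypercube\<close>

text \<open>The labels are consecutive from \<open>i\<close> on; the parameter is there for the recursion.\<close>

fun syndrome :: "nat \<Rightarrow> bool list \<Rightarrow> nat" where
  "syndrome i [] = 0"
| "syndrome i (b # x) = xor (if b then i else 0) (syndrome (Suc i) x)"

lemma syndrome_flip:
  "j < length x \<Longrightarrow> syndrome i (x[j := \<not> x ! j]) = xor (syndrome i x) (i + j)"
proof (induction x arbitrary: i j)
  case (Cons b x)
  have cancel: "xor i (xor i z) = z" for z :: nat by (simp flip: xor.assoc)
  show ?case
    using Cons by (cases j) (auto simp: cancel xor.commute xor.left_commute)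
qed simp

lemma syndrome_less:
  "i + length x \<le> 2 ^ k \<Longrightarrow> syndrome i x < 2 ^ k"
proof (induction x arbitrary: i)
  case (Cons b x)
  then have "syndrome (Suc i) x < 2 ^ k" "(if b then i else 0) < 2 ^ k" by auto
  then have "take_bit k (syndrome i (b # x)) = syndrome i (b # x)"
    by (simp add: take_bit_xor take_bit_nat_eq_self del: if_split)
  then show ?case using take_bit_nat_less_exp by metis
qed simp

lemma hypercube_edge_flip:
  assumes "{x, y} \<in> edges (hypercube n)"
  shows "length x = n \<and> (\<exists>i<n. y = x[i := \<not> x ! i])"
proof -
  have flip: "y = x[i := \<not> x ! i]"
    if "length x = n" "length y = n" "{j. j < n \<and> x ! j \<noteq> y ! j} = {i}" for x y :: "bool list" and i
  proof (rule nth_equalityI)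
    fix j assume "j < length y"
    then show "y ! j = x[i := \<not> x ! i] ! j" using that by (cases "j = i") auto
  qed (use that in simp)
  obtain a b where ab: "{x, y} = {a, b}" "length a = n" "length b = n"
    "card {i. i < n \<and> a ! i \<noteq> b ! i} = 1"
    using assms by (auto simp: hypercube_def)
  have "card {i. i < n \<and> b ! i \<noteq> a ! i} = card {i. i < n \<and> a ! i \<noteq> b ! i}"
    by (rule arg_cong[of _ _ card]) blast
  then have ba: "card {i. i < n \<and> b ! i \<noteq> a ! i} = 1" using ab(4) by (rule trans)
  have "(x = a \<and> y = b) \<or> (x = b \<and> y = a)" using ab(1) by (simp only: doubleton_eq_iff)
  then have len: "length x = n" "length y = n" and "card {i. i < n \<and> x ! i \<noteq> y ! i} = 1"
    using ab(2-4) ba by (elim disjE conjE; simp)+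
  then obtain i where i: "{i. i < n \<and> x ! i \<noteq> y ! i} = {i}" by (auto simp: card_1_singleton_iff)
  then have "i < n" by blast
  then show ?thesis using flip[OF len i] len by blast
qed

text \<open>
  Adjacent vertices have syndromes that differ by a nonzero label, and two neighbours of \<open>w\<close> with
  equal syndromes arise from \<open>w\<close> by flipping coordinates with equal labels, hence the same one.
  Starting the labels at \<open>1\<close> is what makes them all nonzero.
\<close>

lemma packing_syndrome_fibre:
  "packing (hypercube n) {x. length x = n \<and> syndrome 1 x = s}"
  unfolding packing_def
proof (intro conjI ballI allI impI)
  show "{x. length x = n \<and> syndrome 1 x = s} \<subseteq> verts (hypercube n)"
    by (auto simp: hypercube_def)
next
  fix u v assume uv: "u \<in> {x. length x = n \<and> syndrome 1 x = s}"
    "v \<in> {x. length x = n \<and> syndrome 1 x = s}" and "{u, v} \<in> edges (hypercube n)"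
  then obtain i where "i < n" "v = u[i := \<not> u ! i]" using hypercube_edge_flip by blast
  then have "xor s (1 + i) = s" using uv syndrome_flip[of i u 1] by auto
  then have "xor (xor s s) (1 + i) = xor s s" by (metis xor.assoc)
  then show "u = v" by simp
next
  fix u v w assume uv: "u \<in> {x. length x = n \<and> syndrome 1 x = s}"
    "v \<in> {x. length x = n \<and> syndrome 1 x = s}"
    and "{u, w} \<in> edges (hypercube n) \<and> {v, w} \<in> edges (hypercube n)"
  then have "{w, u} \<in> edges (hypercube n)" "{w, v} \<in> edges (hypercube n)"
    by (simp_all add: insert_commute)
  then obtain i j where ij: "length w = n" "i < n" "u = w[i := \<not> w ! i]" "j < n" "v = w[j := \<not> w ! j]"
    using hypercube_edge_flip by meson
  then have "xor (syndrome 1 w) (1 + i) = xor (syndrome 1 w) (1 + j)"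
    using uv syndrome_flip[of i w 1] syndrome_flip[of j w 1] by auto
  then have "xor (xor (syndrome 1 w) (syndrome 1 w)) (1 + i)
      = xor (xor (syndrome 1 w) (syndrome 1 w)) (1 + j)"
    by (metis xor.assoc)
  then show "u = v" using ij by simp
qed

lemma card_verts_hypercube: "card (verts (hypercube n)) = 2 ^ n"
  using card_lists_length_eq[of "UNIV :: bool set" n] by (simp add: hypercube_def)

lemma hypercube_large_packing:
  assumes "n + 1 \<le> 2 ^ k" "k \<le> n"
  obtains C where "packing (hypercube n) C" "2 ^ (n - k) \<le> card C"
proof (rule ccontr)
  note found = that
  let ?V = "verts (hypercube n)" and ?F = "\<lambda>s. {x. length x = n \<and> syndrome 1 x = s}"
  assume "\<not> thesis"
  then have small: "card (?F s) < 2 ^ (n - k)" for s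
    using found packing_syndrome_fibre by (meson not_le)
  have "?V = (\<Union>s<2 ^ k. ?F s)"
    using syndrome_less[of 1 _ k] assms(1) by (auto simp: hypercube_def)
  then have "2 ^ n \<le> (\<Sum>s<2 ^ k. card (?F s))"
    using card_UN_le[of "{..<2 ^ k}" ?F] card_verts_hypercube[of n] by simp
  also have "\<dots> < (\<Sum>s<(2 :: nat) ^ k. 2 ^ (n - k))"
    using small by (intro sum_strict_mono) (auto simp: lessThan_empty_iff)
  also have "\<dots> = 2 ^ n" using assms(2) by (simp flip: power_add)
  finally show False by simp
qed

section \<open>The bound on the maximum forcing number\<close>

theorem corollary4p7:
  fixes n :: nat
  assumes "n \<ge> 1"
  shows "real (max_forcing_number (hypercube n))
           \<le> 2 ^ (n - 1) - 2 powi (int n - \<lceil>log 2 (real n + 1)\<rceil>)"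
proof -
  define k where "k = nat \<lceil>log 2 (real n + 1)\<rceil>"
  have "0 \<le> log 2 (real n + 1)" by simp
  then have ceil: "\<lceil>log 2 (real n + 1)\<rceil> = int k"
    unfolding k_def by linarith
  then have "log 2 (real n + 1) \<le> real k" by linarith
  then have "real n + 1 \<le> 2 ^ k" by (simp add: log_le_iff powr_realpow)
  then have "real (n + 1) \<le> real (2 ^ k)" by simp
  then have k: "n + 1 \<le> 2 ^ k" by (simp only: of_nat_le_iff)
  have "n + 1 \<le> 2 ^ n" using less_exp[of n] by linarith
  then have "real (n + 1) \<le> real (2 ^ n)" by (simp only: of_nat_le_iff)
  then have "log 2 (real n + 1) \<le> real n" by (simp add: log_le_iff powr_realpow)
  then have kn: "k \<le> n" using ceil by linarith
  obtain C where C: "packing (hypercube n) C" "2 ^ (n - k) \<le> card C"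
    using hypercube_large_packing[OF k kn] .
  have bound: "forcing_number (hypercube n) M + 2 ^ (n - k) \<le> 2 ^ (n - 1)"
    if M: "perfect_matching (hypercube n) M" for M
  proof -
    have "2 * card M = 2 * 2 ^ (n - 1)"
      using card_perfect_matching[OF finite_simple_graph_hypercube M] card_verts_hypercube[of n]
        assms by (simp flip: power_Suc)
    then show ?thesis
      using forcing_number_le_packing[OF finite_simple_graph_hypercube M C(1)] C(2) by linarith
  qed
  have "max_forcing_number (hypercube n)
      \<in> {forcing_number (hypercube n) M | M. perfect_matching (hypercube n) M}"
    unfolding max_forcing_number_def
    using max_forcing_number_set[OF finite_simple_graph_hypercube]
      hypercube_has_perfect_matching[OF assms]
    by (intro Max_in) auto
  then have "max_forcing_number (hypercube n) + 2 ^ (n - k) \<le> 2 ^ (n - 1)"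
    using bound by auto
  then have "real (max_forcing_number (hypercube n) + 2 ^ (n - k)) \<le> real (2 ^ (n - 1))"
    by (simp only: of_nat_le_iff)
  moreover have "(2 :: real) powi (int n - \<lceil>log 2 (real n + 1)\<rceil>) = 2 ^ (n - k)"
    using kn by (simp add: ceil power_int_def nat_diff_distrib)
  ultimately show ?thesis by simp
qed

end
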